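(* Let $k\in\mathbb{N}$ and let $G$ be a $k$-colorable graph. Let $A$ be a finite set disjoint from $V(G)$ and let $(L,H)$ be a cover of $\mathcal{J}(G,A)$ such that $|L(a)| \ge |A|+k$ for all $a\in A$. Suppose that $$|A| \ \ge\ \frac{3}{2}\sum_{v\in V(G)} \max\{\deg_G(v) + |A| - |L(v)| + 1,\ 0\}.$$ Then $\mathcal{J}(G,A)$ is $(L,H)$-colorable.
   Context: All graphs are finite, undirected and simple. For a graph $G$ and a finite set $A$ disjoint from $V(G)$, $\mathcal{J}(G,A)$ denotes the graph with vertex set $V(G)\cup A$ obtained from $G$ by adding all edges (pairs of distinct vertices) with at least one endpoint in $A$. A cover of a graph $G$ is a pair $(L,H)$, where $H$ is a graph and $L\colon V(G)\to 2^{V(H)}$, such that: the sets $L(u)$, $u\in V(G)$, partition $V(H)$; if $u,v\in V(G)$ and some vertex of $L(v)$ is adjacent in $H$ to some vertex of $L(u)$, then $v=u$ or $uv\in E(G)$; each $H[L(u)]$ is a complete graph; and if $uv\in E(G)$, then the set of edges of $H$ between $L(u)$ and $L(v)$ is a matching (possibly empty). An $(L,H)$-coloring of $G$ is an independent set $I$ of $H$ with $|I\cap L(u)|=1$ for all $u\in V(G)$. *)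

theory Defs
  imports Complex_Main "HOL-Library.Disjoint_Sets" "Graph_Theory.Graph_Theory"
begin

text \<open>
  A finite undirected simple graph is a \<^locale>\<open>pair_graph\<close>: an edge between \<open>u\<close> and \<open>v\<close>
  is represented by the two arcs \<open>(u, v)\<close> and \<open>(v, u)\<close>. Hence the degree of a vertex is its
  \<^const>\<open>out_degree\<close>.
\<close>

abbreviation vertex_degree :: "'a pair_pre_digraph \<Rightarrow> 'a \<Rightarrow> nat" where
  "vertex_degree G v \<equiv> out_degree (with_proj G) v"

definition colorable :: "nat \<Rightarrow> 'a pair_pre_digraph \<Rightarrow> bool" where
  "colorable k G \<longleftrightarrow>
     (\<exists>c :: 'a \<Rightarrow> nat. (\<forall>v \<in> pverts G. c v < k) \<and> (\<forall>(u, v) \<in> parcs G. c u \<noteq> c v))"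

definition clique_join :: "'a pair_pre_digraph \<Rightarrow> 'a set \<Rightarrow> 'a pair_pre_digraph" (\<open>\<J>\<close>) where
  "\<J> G A = \<lparr> pverts = pverts G \<union> A,
             parcs = parcs G \<union>
               {(u, v). u \<in> pverts G \<union> A \<and> v \<in> pverts G \<union> A \<and> u \<noteq> v \<and> (u \<in> A \<or> v \<in> A)} \<rparr>"

lemma pair_graph_clique_join:
  assumes "pair_graph G" "finite A"
  shows "pair_graph (\<J> G A)"
proof -
  interpret pair_graph G by fact
  have "parcs (\<J> G A) \<subseteq> (pverts G \<union> A) \<times> (pverts G \<union> A)"
    by (auto simp: clique_join_def dest: in_arcsD1 in_arcsD2)
  moreover have "finite ((pverts G \<union> A) \<times> (pverts G \<union> A))"
    using assms(2) pair_finite_verts by simp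
  ultimately have "finite (parcs (\<J> G A))"
    by (rule finite_subset)
  then show ?thesis
    using assms(2) pair_finite_verts
    by unfold_locales
       (auto simp: clique_join_def symmetric_def sym_def
         dest: in_arcsD1 in_arcsD2 no_loops' intro: arcs_symmetric)
qed

text \<open>Undirected edges, as two-element sets, so that each edge is counted once.\<close>

definition edges_between :: "'b pair_pre_digraph \<Rightarrow> 'b set \<Rightarrow> 'b set \<Rightarrow> 'b set set" where
  "edges_between H X Y = {{x, y} | x y. x \<in> X \<and> y \<in> Y \<and> (x, y) \<in> parcs H}"

definition matching :: "'b set set \<Rightarrow> bool" where
  "matching M \<longleftrightarrow> pairwise disjnt M"

text \<open>
  The values of \<open>L\<close> outside the vertex set of \<open>G\<close> are irrelevant. The parts \<open>L u\<close> of the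
  partition may be empty, so it is stated for the indexed family and not by \<^const>\<open>partition_on\<close>.
\<close>

definition cover :: "'a pair_pre_digraph \<Rightarrow> ('a \<Rightarrow> 'b set) \<Rightarrow> 'b pair_pre_digraph \<Rightarrow> bool" where
  "cover G L H \<longleftrightarrow>
     pair_graph H \<and>
     (\<Union>u \<in> pverts G. L u) = pverts H \<and> disjoint_family_on L (pverts G) \<and>
     (\<forall>u \<in> pverts G. \<forall>v \<in> pverts G.
        (\<exists>x \<in> L v. \<exists>y \<in> L u. (x, y) \<in> parcs H) \<longrightarrow> v = u \<or> (u, v) \<in> parcs G) \<and>
     (\<forall>u \<in> pverts G. complete_digraph (card (L u)) (with_proj H \<restriction> L u)) \<and>
     (\<forall>(u, v) \<in> parcs G. matching (edges_between H (L u) (L v)))"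

definition independent_set :: "'b pair_pre_digraph \<Rightarrow> 'b set \<Rightarrow> bool" where
  "independent_set H I \<longleftrightarrow> I \<subseteq> pverts H \<and> (\<forall>x \<in> I. \<forall>y \<in> I. (x, y) \<notin> parcs H)"

definition cover_coloring ::
    "'a pair_pre_digraph \<Rightarrow> ('a \<Rightarrow> 'b set) \<Rightarrow> 'b pair_pre_digraph \<Rightarrow> 'b set \<Rightarrow> bool" where
  "cover_coloring G L H I \<longleftrightarrow> independent_set H I \<and> (\<forall>u \<in> pverts G. card (I \<inter> L u) = 1)"

definition cover_colorable ::
    "'a pair_pre_digraph \<Rightarrow> ('a \<Rightarrow> 'b set) \<Rightarrow> 'b pair_pre_digraph \<Rightarrow> bool" where
  "cover_colorable G L H \<longleftrightarrow> (\<exists>I. cover_coloring G L H I)"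

end

theory Submission
  imports Defs
begin

text \<open>
  Take a counterexample with the fewest vertices and let \<open>s v\<close> be the excess
  \<open>deg v + |A| - |L v| + 1\<close>. A vertex with \<open>s v \<le> 0\<close> can be coloured last, so all excesses are
  positive. Colouring a set \<open>S \<subseteq> A\<close> lowers \<open>s v\<close> by \<open>|S|\<close> minus the number of colours lost by \<open>L v\<close>;
  by minimality the total gain is less than \<open>2/3 |S|\<close>. For \<open>|S| = 1\<close> this says that every colour
  \<open>x \<in> L a\<close> with \<open>a \<in> A\<close> has a neighbour in every \<open>L v\<close>.

  Fix such an \<open>x\<close> and call a colour \<open>y \<in> L b\<close> with \<open>b \<in> A - {a}\<close> bad at \<open>v\<close> if it is not adjacent to \<open>x\<close> but has
  the same neighbour in \<open>L v\<close>. If no colour were bad at the vertices of a colour class \<open>I\<close> of \<open>G\<close>,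
  one could give every \<open>v \<in> I\<close> the neighbour of \<open>x\<close>: this costs each list of \<open>A\<close> at most one colour,
  and \<open>I\<close> is gone together with one of the \<open>k\<close> colours. In general the
  vertices of \<open>A\<close> that have bad colours for \<open>I\<close> must be coloured as well, which is affordable if there
  are at most \<open>3/2 \<Sum>\<^sub>I s\<close> of them. The gain bound for \<open>|S| = 2, 3\<close> shows that a colour is bad at one vertex
  only and that bad colours in different lists are adjacent. Hence either all bad colours lie in a
  single list, or each list has bad colours for a single vertex of \<open>G\<close>; then the numbers for the
  various classes add up to at most \<open>|A| - 1\<close>, which is less than \<open>3/2 \<Sum> s\<close>, and some class is
  affordable.
\<close>

section \<open>Covers of a join as lists with a conflict relation\<close>

locale conflict_graph =
  fixes E :: "'a \<Rightarrow> 'a \<Rightarrow> bool"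
    and C :: "'b \<Rightarrow> 'b \<Rightarrow> bool"
    and c :: "'a \<Rightarrow> nat"
  assumes E_sym: "E u v \<Longrightarrow> E v u"
    and C_sym: "C x y \<Longrightarrow> C y x"
    and proper: "E u v \<Longrightarrow> c u \<noteq> c v"
begin

text \<open>The matching condition appears as uniqueness of the neighbour of \<open>x\<close> in
  another list, over ordered pairs of vertices. Only conflicts within \<open>V\<close> are tied to
  \<open>E\<close>, because in the join every vertex of \<open>A\<close> is adjacent to all
  others.\<close>

definition list_cover :: "'a set \<Rightarrow> 'a set \<Rightarrow> ('a \<Rightarrow> 'b set) \<Rightarrow> bool" where
  "list_cover V A L \<longleftrightarrow> finite V \<and> finite A \<and> V \<inter> A = {} \<and> (\<forall>u\<in>V \<union> A. finite (L u)) \<and>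
     (\<forall>u\<in>V \<union> A. \<forall>v\<in>V \<union> A. u \<noteq> v \<longrightarrow>
        (\<forall>x\<in>L u. \<forall>y\<in>L v. \<forall>z\<in>L v. C x y \<longrightarrow> C x z \<longrightarrow> y = z)) \<and>
     (\<forall>u\<in>V. \<forall>v\<in>V. u \<noteq> v \<longrightarrow> \<not> E u v \<longrightarrow> (\<forall>x\<in>L u. \<forall>y\<in>L v. \<not> C x y))"

definition colorable_from :: "'a set \<Rightarrow> ('a \<Rightarrow> 'b set) \<Rightarrow> bool" where
  "colorable_from W L \<longleftrightarrow>
     (\<exists>\<phi>. (\<forall>u\<in>W. \<phi> u \<in> L u) \<and> (\<forall>u\<in>W. \<forall>v\<in>W. u \<noteq> v \<longrightarrow> \<not> C (\<phi> u) (\<phi> v)))"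

text \<open>Degrees are counted inside \<open>V\<close>, so they drop when vertices are deleted. The
  type \<open>int\<close> avoids truncated subtraction.\<close>

definition excess :: "'a set \<Rightarrow> 'a set \<Rightarrow> ('a \<Rightarrow> 'b set) \<Rightarrow> 'a \<Rightarrow> int" where
  "excess V A L v = int (card {u\<in>V. E v u}) + int (card A) - int (card (L v)) + 1"

definition weight :: "'a set \<Rightarrow> 'a set \<Rightarrow> ('a \<Rightarrow> 'b set) \<Rightarrow> int" where
  "weight V A L = (\<Sum>v\<in>V. max (excess V A L v) 0)"

text \<open>
  The colouring \<open>c\<close> of the base graph stays fixed, so deleting a whole colour class lowers the
  number \<open>card (c ` V)\<close> of colours in use.
\<close>

definition admissible :: "'a set \<Rightarrow> 'a set \<Rightarrow> ('a \<Rightarrow> 'b set) \<Rightarrow> bool" where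
  "admissible V A L \<longleftrightarrow> list_cover V A L \<and> (\<forall>a\<in>A. card A + card (c ` V) \<le> card (L a)) \<and>
     3 * weight V A L \<le> 2 * int (card A)"

text \<open>Encoded as a set of vertex-colour pairs, so that colourings of two or three vertices and
  unions of colourings are plain set expressions.\<close>

definition partial_coloring :: "('a \<times> 'b) set \<Rightarrow> 'a set \<Rightarrow> ('a \<Rightarrow> 'b set) \<Rightarrow> bool" where
  "partial_coloring S W L \<longleftrightarrow> finite S \<and> fst ` S \<subseteq> W \<and> inj_on fst S \<and> (\<forall>p\<in>S. snd p \<in> L (fst p)) \<and>
     (\<forall>p\<in>S. \<forall>q\<in>S. p \<noteq> q \<longrightarrow> \<not> C (snd p) (snd q))"

definition lost :: "('a \<Rightarrow> 'b set) \<Rightarrow> ('a \<times> 'b) set \<Rightarrow> 'a \<Rightarrow> 'b set" where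
  "lost L S u = {y\<in>L u. \<exists>p\<in>S. C (snd p) y}"

definition residual :: "('a \<Rightarrow> 'b set) \<Rightarrow> ('a \<times> 'b) set \<Rightarrow> 'a \<Rightarrow> 'b set" where
  "residual L S u = L u - lost L S u"

lemma list_coverD:
  assumes "list_cover V A L"
  shows "finite V" "finite A" "V \<inter> A = {}" "u \<in> V \<union> A \<Longrightarrow> finite (L u)"
    "\<lbrakk>u \<in> V \<union> A; v \<in> V \<union> A; u \<noteq> v; x \<in> L u; y \<in> L v; z \<in> L v; C x y; C x z\<rbrakk> \<Longrightarrow> y = z"
    "\<lbrakk>u \<in> V; v \<in> V; u \<noteq> v; x \<in> L u; y \<in> L v; C x y\<rbrakk> \<Longrightarrow> E u v"
  using assms unfolding list_cover_def by (simp, simp, simp, simp, blast, blast)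

lemma list_cover_mono:
  assumes "list_cover V A L" "V' \<subseteq> V" "A' \<subseteq> A" "\<And>u. L' u \<subseteq> L u"
  shows "list_cover V' A' L'"
proof -
  note D = list_coverD[OF assms(1)]
  have sub: "\<And>u. u \<in> V' \<union> A' \<Longrightarrow> u \<in> V \<union> A" "\<And>u. u \<in> V' \<Longrightarrow> u \<in> V"
    "\<And>u x. x \<in> L' u \<Longrightarrow> x \<in> L u"
    using assms by blast+
  show ?thesis
    unfolding list_cover_def
  proof (intro conjI ballI impI notI)
    show "finite V'" using finite_subset[OF assms(2) D(1)] .
    show "finite A'" using finite_subset[OF assms(3) D(2)] .
    show "V' \<inter> A' = {}" using D(3) assms(2,3) by blast
    show "finite (L' u)" if "u \<in> V' \<union> A'" for u
      using D(4)[of u] sub(1)[OF that] assms(4) finite_subset by blast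
    show "y = z" if "u \<in> V' \<union> A'" "v \<in> V' \<union> A'" "u \<noteq> v" "x \<in> L' u" "y \<in> L' v" "z \<in> L' v" "C x y" "C x z"
      for u v x y z
      using D(5)[of u v x y z] sub that by simp
    show False if "u \<in> V'" "v \<in> V'" "u \<noteq> v" "\<not> E u v" "x \<in> L' u" "y \<in> L' v" "C x y" for u v x y
      using D(6)[of u v x y] sub that by blast
  qed
qed

lemma residual_subset: "residual L S u \<subseteq> L u"
  by (auto simp: residual_def)

section \<open>Extending partial colourings\<close>

lemma colorable_from_extend:
  assumes S: "partial_coloring S W L" and rest: "colorable_from (W - fst ` S) (residual L S)"
  shows "colorable_from W L"
proof -
  obtain \<phi> where \<phi>: "\<And>u. u \<in> W - fst ` S \<Longrightarrow> \<phi> u \<in> residual L S u"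
    "\<And>u v. u \<in> W - fst ` S \<Longrightarrow> v \<in> W - fst ` S \<Longrightarrow> u \<noteq> v \<Longrightarrow> \<not> C (\<phi> u) (\<phi> v)"
    using rest unfolding colorable_from_def by metis
  have "\<forall>u\<in>fst ` S. \<exists>x. (u, x) \<in> S" by force
  then obtain \<psi> where \<psi>: "\<And>u. u \<in> fst ` S \<Longrightarrow> (u, \<psi> u) \<in> S" by metis
  define \<chi> where "\<chi> u = (if u \<in> fst ` S then \<psi> u else \<phi> u)" for u
  have cross: "\<not> C (\<psi> u) (\<phi> v)" if "u \<in> fst ` S" "v \<in> W - fst ` S" for u v
    using \<phi>(1)[OF that(2)] bspec[of S _ "(u, \<psi> u)"] \<psi>[OF that(1)]
    unfolding residual_def lost_def by auto
  have SD: "\<And>p. p \<in> S \<Longrightarrow> snd p \<in> L (fst p)"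
    "\<And>p q. p \<in> S \<Longrightarrow> q \<in> S \<Longrightarrow> p \<noteq> q \<Longrightarrow> \<not> C (snd p) (snd q)"
    using S unfolding partial_coloring_def by blast+
  have "\<chi> u \<in> L u" if "u \<in> W" for u
  proof (cases "u \<in> fst ` S")
    case True
    then show ?thesis using SD(1)[OF \<psi>[OF True]] unfolding \<chi>_def by simp
  next
    case False
    then show ?thesis using \<phi>(1)[of u] that residual_subset[of L S u] unfolding \<chi>_def by auto
  qed
  moreover have "\<not> C (\<chi> u) (\<chi> v)" if "u \<in> W" "v \<in> W" "u \<noteq> v" for u v
  proof (cases "u \<in> fst ` S"; cases "v \<in> fst ` S")
    assume "u \<in> fst ` S" "v \<in> fst ` S"
    then show ?thesis
      using SD(2)[OF \<psi>[of u] \<psi>[of v]] that unfolding \<chi>_def by simp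
  next
    assume "u \<notin> fst ` S" "v \<in> fst ` S"
    then show ?thesis
      using cross[of v u] C_sym that unfolding \<chi>_def by auto
  next
    assume "u \<in> fst ` S" "v \<notin> fst ` S"
    then show ?thesis using cross[of u v] that unfolding \<chi>_def by auto
  next
    assume "u \<notin> fst ` S" "v \<notin> fst ` S"
    then show ?thesis using \<phi>(2)[of u v] that unfolding \<chi>_def by auto
  qed
  ultimately show ?thesis
    unfolding colorable_from_def by blast
qed

text \<open>By the matching condition each pair of \<open>S\<close> removes at most one colour from
  \<open>L u\<close>. It suffices that \<open>T\<close> accounts for all lost colours; this beats
  \<open>card S\<close> when several pairs remove the same colour or some remove none.\<close>

lemma card_lost_le:
  assumes cover: "list_cover V A L" and S: "partial_coloring S (V \<union> A) L"
    and u: "u \<in> V \<union> A" "u \<notin> fst ` S"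
    and T: "T \<subseteq> S" "\<And>y. y \<in> lost L S u \<Longrightarrow> \<exists>p\<in>T. C (snd p) y"
  shows "card (lost L S u) \<le> card T"
proof -
  have finT: "finite T" using S T(1) finite_subset unfolding partial_coloring_def by blast
  have fin: "finite (L u)" using list_coverD(4)[OF cover u(1)] .
  have one: "card {y\<in>L u. C (snd p) y} \<le> 1" if "p \<in> T" for p
  proof -
    have p: "p \<in> S" using that T by blast
    have "fst p \<in> V \<union> A" "snd p \<in> L (fst p)" "fst p \<noteq> u"
      using p S u unfolding partial_coloring_def by auto
    then have "\<forall>y\<in>{y\<in>L u. C (snd p) y}. \<forall>z\<in>{y\<in>L u. C (snd p) y}. y = z"
      using list_coverD(5)[OF cover, of "fst p" u "snd p"] u by blast
    then show ?thesis
      using card_le_Suc0_iff_eq[of "{y\<in>L u. C (snd p) y}"] fin by simp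
  qed
  have "card (lost L S u) \<le> card (\<Union>p\<in>T. {y\<in>L u. C (snd p) y})"
    using T(2) finT fin by (intro card_mono) (auto simp: lost_def)
  also have "\<dots> \<le> (\<Sum>p\<in>T. card {y\<in>L u. C (snd p) y})"
    by (rule card_UN_le[OF finT])
  also have "\<dots> \<le> card T"
    using sum_mono[of T _ "\<lambda>_. 1", OF one] by simp
  finally show ?thesis .
qed

lemma card_lost_le_card:
  assumes "list_cover V A L" "partial_coloring S (V \<union> A) L" "u \<in> V \<union> A" "u \<notin> fst ` S"
  shows "card (lost L S u) \<le> card S"
  by (rule card_lost_le[OF assms subset_refl]) (auto simp: lost_def)

lemma card_residual:
  assumes "finite (L u)"
  shows "int (card (residual L S u)) = int (card (L u)) - int (card (lost L S u))"
proof -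
  have "lost L S u \<subseteq> L u" by (auto simp: lost_def)
  then show ?thesis
    unfolding residual_def using assms by (simp add: card_Diff_subset finite_subset card_mono of_nat_diff)
qed

lemma card_fst_partial_coloring: "partial_coloring S W L \<Longrightarrow> card (fst ` S) = card S"
  unfolding partial_coloring_def by (simp add: card_image)

lemma partial_coloring_Un:
  assumes S: "partial_coloring S W L" and T: "partial_coloring T W L"
    and disj: "fst ` S \<inter> fst ` T = {}"
    and cross: "\<And>p q. p \<in> S \<Longrightarrow> q \<in> T \<Longrightarrow> \<not> C (snd p) (snd q)"
  shows "partial_coloring (S \<union> T) W L"
  unfolding partial_coloring_def
proof (intro conjI ballI impI)
  note SD = S[unfolded partial_coloring_def] and TD = T[unfolded partial_coloring_def]
  show "finite (S \<union> T)" "fst ` (S \<union> T) \<subseteq> W" using SD TD by (simp_all add: image_Un)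
  show "inj_on fst (S \<union> T)" using SD TD disj by (simp add: inj_on_Un) blast
  show "snd p \<in> L (fst p)" if "p \<in> S \<union> T" for p using SD TD that by blast
  show "\<not> C (snd p) (snd q)" if "p \<in> S \<union> T" "q \<in> S \<union> T" "p \<noteq> q" for p q
  proof (cases "p \<in> S"; cases "q \<in> S")
    assume "p \<in> S" "q \<in> S"
    then show ?thesis using SD that(3) by blast
  next
    assume "p \<in> S" "q \<notin> S"
    then show ?thesis using cross that(2) by blast
  next
    assume "p \<notin> S" "q \<in> S"
    then show ?thesis using cross[of q p] C_sym that(1) by blast
  next
    assume "p \<notin> S" "q \<notin> S"
    then show ?thesis using TD that by blast
  qed
qed

text \<open>Only colours at vertices of \<open>T\<close> can conflict with \<open>L v\<close>. They
  exclude at most \<open>card T\<close> colours, so one remains for \<open>v\<close>.\<close>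

lemma colorable_from_insert:
  assumes cover: "list_cover V A L" and v: "v \<in> V \<union> A" and W: "W \<subseteq> V \<union> A" "v \<notin> W"
    and col: "colorable_from W L" and T: "T \<subseteq> W" "card T < card (L v)"
    and noconf: "\<And>u x y. u \<in> W - T \<Longrightarrow> x \<in> L u \<Longrightarrow> y \<in> L v \<Longrightarrow> \<not> C x y"
  shows "colorable_from (insert v W) L"
proof -
  obtain \<phi> where \<phi>: "\<And>u. u \<in> W \<Longrightarrow> \<phi> u \<in> L u" "\<And>u w. u \<in> W \<Longrightarrow> w \<in> W \<Longrightarrow> u \<noteq> w \<Longrightarrow> \<not> C (\<phi> u) (\<phi> w)"
    using col unfolding colorable_from_def by metis
  have finW: "finite W" using list_coverD(1,2)[OF cover] W finite_subset by blast
  define S where "S = (\<lambda>u. (u, \<phi> u)) ` W"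
  have fstS: "fst ` S = W" unfolding S_def by force
  have S: "partial_coloring S (V \<union> A) L"
    using \<phi> W finW unfolding partial_coloring_def S_def by (auto simp: inj_on_def)
  have "card (lost L S v) \<le> card ((\<lambda>u. (u, \<phi> u)) ` T)"
  proof (rule card_lost_le[OF cover S v])
    show "v \<notin> fst ` S" using fstS W by simp
    show "(\<lambda>u. (u, \<phi> u)) ` T \<subseteq> S" unfolding S_def using T by blast
    show "\<exists>p\<in>(\<lambda>u. (u, \<phi> u)) ` T. C (snd p) y" if "y \<in> lost L S v" for y
    proof -
      obtain u where u: "u \<in> W" "C (\<phi> u) y" "y \<in> L v" using \<open>y \<in> lost L S v\<close> unfolding lost_def S_def by auto
      then have "u \<in> T" using noconf[of u "\<phi> u" y] \<phi>(1) by blast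
      then show ?thesis using u by auto
    qed
  qed
  also have "\<dots> \<le> card T"
    by (rule card_image_le[OF finite_subset[OF T(1) finW]])
  finally have "card (lost L S v) < card (L v)" using T by simp
  moreover have "finite (lost L S v)" using list_coverD(4)[OF cover v] by (simp add: lost_def)
  ultimately have "\<not> L v \<subseteq> lost L S v"
    using card_mono[of "lost L S v" "L v"] by linarith
  then obtain y where y: "y \<in> L v" "\<And>u. u \<in> W \<Longrightarrow> \<not> C (\<phi> u) y"
    unfolding lost_def S_def by auto
  have y': "\<not> C y (\<phi> u)" if "u \<in> W" for u
    using y(2)[OF that] C_sym by blast
  have "(\<forall>u\<in>insert v W. (\<phi>(v := y)) u \<in> L u) \<and>
      (\<forall>u\<in>insert v W. \<forall>w\<in>insert v W. u \<noteq> w \<longrightarrow> \<not> C ((\<phi>(v := y)) u) ((\<phi>(v := y)) w))"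
    using \<phi> y y' W(2) by auto
  then show ?thesis
    unfolding colorable_from_def by blast
qed

lemma colorable_from_greedy:
  assumes cover: "list_cover V A L" and B: "B \<subseteq> V \<union> A" "\<And>b. b \<in> B \<Longrightarrow> card B \<le> card (L b)"
  shows "colorable_from B L"
proof -
  have "finite B" using list_coverD(1,2)[OF cover] B finite_subset by blast
  then show ?thesis
    using B
  proof (induction B)
    case empty
    show ?case unfolding colorable_from_def by simp
  next
    case (insert b B)
    have "card B \<le> card (L b')" if "b' \<in> B" for b'
      using insert.prems(2)[of b'] insert.hyps that by simp
    then have "colorable_from B L" using insert by simp
    moreover have "card B < card (L b)" using insert.prems(2)[of b] insert.hyps by simp
    ultimately show ?case
      using colorable_from_insert[OF cover, of b B B] insert by auto
  qed
qed

text \<open>Nonpositive excess means that \<open>L v\<close> is longer than the degree of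
  \<open>v\<close> in the join.\<close>

lemma colorable_from_nonpos_excess:
  assumes cover: "list_cover V A L" and v: "v \<in> V" "excess V A L v \<le> 0"
    and col: "colorable_from (V - {v} \<union> A) L"
  shows "colorable_from (V \<union> A) L"
proof -
  note D = list_coverD[OF cover]
  let ?T = "{u\<in>V. E v u} \<union> A"
  have "card ?T \<le> card {u\<in>V. E v u} + card A" by (rule card_Un_le)
  then have T: "card ?T < card (L v)" using v(2) unfolding excess_def by linarith
  have "v \<notin> A" using v(1) D(3) by blast
  have "colorable_from (insert v (V - {v} \<union> A)) L"
  proof (rule colorable_from_insert[OF cover _ _ _ col _ T])
    show "?T \<subseteq> V - {v} \<union> A" using proper by blast
    show "\<not> C x y" if "u \<in> V - {v} \<union> A - ?T" "x \<in> L u" "y \<in> L v" for u x y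
      using D(6)[of v u y x] C_sym that v by blast
  qed (use v \<open>v \<notin> A\<close> in auto)
  moreover have "insert v (V - {v} \<union> A) = V \<union> A" using v by blast
  ultimately show ?thesis by simp
qed

lemma weight_mono:
  assumes "\<And>v. v \<in> V' \<Longrightarrow> excess V' A' L' v \<le> excess V A L v"
  shows "weight V' A' L' \<le> (\<Sum>v\<in>V'. max (excess V A L v) 0)"
  unfolding weight_def using assms by (intro sum_mono max.mono) auto

end

section \<open>A counterexample minimal in \<open>card V + card A\<close>\<close>

locale minimal_counterexample = conflict_graph E C c
  for E :: "'a \<Rightarrow> 'a \<Rightarrow> bool" and C :: "'b \<Rightarrow> 'b \<Rightarrow> bool" and c :: "'a \<Rightarrow> nat" +
  fixes V A :: "'a set" and L :: "'a \<Rightarrow> 'b set"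
  assumes admissible: "admissible V A L"
    and not_colorable: "\<not> colorable_from (V \<union> A) L"
    and smaller_colorable: "\<And>V' A' L'. admissible V' A' L' \<Longrightarrow> card V' + card A' < card V + card A \<Longrightarrow>
       colorable_from (V' \<union> A') L'"
begin

abbreviation s :: "'a \<Rightarrow> int" where "s \<equiv> excess V A L"

lemma cover: "list_cover V A L" and large: "a \<in> A \<Longrightarrow> card A + card (c ` V) \<le> card (L a)"
  and bound: "3 * weight V A L \<le> 2 * int (card A)"
  using admissible unfolding admissible_def by auto

lemmas finV = list_coverD(1)[OF cover] and finA = list_coverD(2)[OF cover]
  and disj = list_coverD(3)[OF cover] and finL = list_coverD(4)[OF cover]
  and matched = list_coverD(5)[OF cover] and adjacent = list_coverD(6)[OF cover]

lemma excess_pos: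
  assumes v: "v \<in> V"
  shows "s v \<ge> 1"
proof (rule ccontr)
  assume "\<not> s v \<ge> 1"
  then have nonpos: "s v \<le> 0" by simp
  have le: "excess (V - {v}) A L u \<le> s u" for u
    unfolding excess_def using finV by (simp add: card_mono subset_iff)
  have "weight (V - {v}) A L \<le> (\<Sum>u\<in>V - {v}. max (s u) 0)"
    by (intro weight_mono le)
  also have "\<dots> \<le> weight V A L"
    unfolding weight_def using finV by (intro sum_mono2) auto
  finally have w: "3 * weight (V - {v}) A L \<le> 2 * int (card A)" using bound by linarith
  have k: "card (c ` (V - {v})) \<le> card (c ` V)" using finV by (intro card_mono) auto
  have "admissible (V - {v}) A L"
    unfolding admissible_def using w k large list_cover_mono[OF cover, of "V - {v}" A L]
    by fastforce
  moreover have "card (V - {v}) < card V" using finV v by (intro psubset_card_mono) auto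
  ultimately have "colorable_from (V - {v} \<union> A) L" using smaller_colorable by simp
  then show False
    using colorable_from_nonpos_excess[OF cover v nonpos] not_colorable by simp
qed

lemma weight_eq: "weight V A L = (\<Sum>v\<in>V. s v)"
  unfolding weight_def using excess_pos by (intro sum.cong) fastforce+

text \<open>Colouring \<open>S\<close> shrinks \<open>A\<close> by \<open>card S\<close> and takes
  at most \<open>card S\<close> colours from each remaining list of \<open>A\<close>, so the size
  condition survives and only the weight has to be checked. \<open>V'\<close> leaves room for
  deleting vertices as well.\<close>

lemma residual_admissible:
  assumes S: "partial_coloring S A L" and V': "V' \<subseteq> V"
    and w: "3 * weight V' (A - fst ` S) (residual L S) \<le> 2 * (int (card A) - int (card S))"
  shows "admissible V' (A - fst ` S) (residual L S)"
  unfolding admissible_def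
proof (intro conjI ballI)
  have S': "partial_coloring S (V \<union> A) L" using S unfolding partial_coloring_def by auto
  have sub: "fst ` S \<subseteq> A" using S unfolding partial_coloring_def by simp
  have cA: "card (A - fst ` S) = card A - card S" "card S \<le> card A"
    using card_fst_partial_coloring[OF S] sub finA card_mono[OF finA sub]
    by (simp_all add: card_Diff_subset finite_subset)
  show "list_cover V' (A - fst ` S) (residual L S)"
    using list_cover_mono[OF cover V', of "A - fst ` S"] residual_subset by blast
  show "3 * weight V' (A - fst ` S) (residual L S) \<le> 2 * int (card (A - fst ` S))"
    using w cA by simp
  show "card (A - fst ` S) + card (c ` V') \<le> card (residual L S a)" if a: "a \<in> A - fst ` S" for a
  proof -
    have "card (lost L S a) \<le> card S"
      using card_lost_le_card[OF cover S'] a by simp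
    moreover have "card (c ` V') \<le> card (c ` V)" using V' finV by (intro card_mono) auto
    ultimately show ?thesis
      using card_residual[of L a S] finL[of a] large[of a] a cA by simp
  qed
qed

lemma excess_residual:
  assumes S: "partial_coloring S A L" and v: "v \<in> V"
  shows "excess V (A - fst ` S) (residual L S) v = s v - (int (card S) - int (card (lost L S v)))"
proof -
  have sub: "fst ` S \<subseteq> A" using S unfolding partial_coloring_def by simp
  have "int (card (A - fst ` S)) = int (card A) - int (card S)"
    using card_fst_partial_coloring[OF S] sub finA card_mono[OF finA sub]
    by (simp add: card_Diff_subset finite_subset)
  then show ?thesis
    unfolding excess_def using card_residual[of L v S] finL[of v] v by simp
qed

lemma card_lost_le_partial:
  assumes S: "partial_coloring S A L" and v: "v \<in> V"
    and T: "T \<subseteq> S" "\<And>y. y \<in> lost L S v \<Longrightarrow> \<exists>p\<in>T. C (snd p) y"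
  shows "card (lost L S v) \<le> card T"
proof (rule card_lost_le[OF cover _ _ _ T])
  show "partial_coloring S (V \<union> A) L" using S unfolding partial_coloring_def by auto
  show "v \<in> V \<union> A" using v by simp
  show "v \<notin> fst ` S" using S v disj unfolding partial_coloring_def by blast
qed

lemma not_colorable_residual:
  assumes S: "partial_coloring S A L"
  shows "\<not> colorable_from (V \<union> (A - fst ` S)) (residual L S)"
proof -
  have S': "partial_coloring S (V \<union> A) L" using S unfolding partial_coloring_def by auto
  have "V \<union> A - fst ` S = V \<union> (A - fst ` S)" using S disj unfolding partial_coloring_def by blast
  then show ?thesis using colorable_from_extend[OF S'] not_colorable by auto
qed

section \<open>Gain from colouring part of \<open>A\<close>\<close>

text \<open>The second argument of \<open>min\<close> is the drop of the excess; the cap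
  \<open>s v\<close> reflects that \<open>weight\<close> counts negative excess as 0.\<close>

definition gain :: "('a \<times> 'b) set \<Rightarrow> 'a \<Rightarrow> int" where
  "gain S v = min (s v) (int (card S) - int (card (lost L S v)))"

lemma gain_nonneg:
  assumes S: "partial_coloring S A L" and v: "v \<in> V"
  shows "0 \<le> gain S v"
proof -
  have "card (lost L S v) \<le> card S"
    using card_lost_le_partial[OF S v subset_refl] unfolding lost_def by simp
  then show ?thesis using excess_pos[OF v] unfolding gain_def by simp
qed

text \<open>What \<open>S\<close> leaves has weight \<open>weight V A L\<close> minus the total
  gain. If it met the weight bound it would be admissible, hence colourable by minimality, and the
  colouring would extend by \<open>S\<close>.\<close>

lemma weight_after_gain:
  assumes S: "partial_coloring S A L" and ne: "S \<noteq> {}"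
  shows "2 * (int (card A) - int (card S)) < 3 * (weight V A L - (\<Sum>v\<in>V. gain S v))"
proof (rule ccontr)
  let ?A = "A - fst ` S" and ?L = "residual L S"
  assume *: "\<not> ?thesis"
  have "weight V ?A ?L = (\<Sum>v\<in>V. s v - gain S v)"
    unfolding weight_def gain_def using excess_residual[OF S] by (intro sum.cong) auto
  also have "\<dots> = weight V A L - (\<Sum>v\<in>V. gain S v)"
    by (simp add: weight_eq sum_subtractf)
  finally have "3 * weight V ?A ?L \<le> 2 * (int (card A) - int (card S))"
    using * by (simp only: not_less)
  then have "admissible V ?A ?L" using residual_admissible[OF S] by simp
  moreover have "fst ` S \<subseteq> A" "fst ` S \<noteq> {}"
    using S ne unfolding partial_coloring_def by auto
  then have "?A \<subset> A" by blast
  then have "card ?A < card A" using finA by (rule psubset_card_mono[rotated])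
  ultimately have "colorable_from (V \<union> ?A) ?L" using smaller_colorable by simp
  then show False using not_colorable_residual[OF S] by simp
qed

text \<open>By integrality the total gain is 0 if \<open>card S = 1\<close> and at most 1 if
  \<open>card S\<close> is 2 or 3; these are the cases used below.\<close>

lemma gain_less:
  assumes S: "partial_coloring S A L" and ne: "S \<noteq> {}" and U: "U \<subseteq> V"
  shows "3 * (\<Sum>v\<in>U. gain S v) < 2 * int (card S)"
proof -
  have "(\<Sum>v\<in>U. gain S v) \<le> (\<Sum>v\<in>V. gain S v)"
    using gain_nonneg[OF S] by (intro sum_mono2[OF finV U]) simp
  then show ?thesis
    using weight_after_gain[OF S ne] bound by (simp add: right_diff_distrib)
qed

lemma card_V_le_weight: "int (card V) \<le> weight V A L"
  using sum_mono[of V "\<lambda>_. 1" s] excess_pos by (simp add: weight_eq)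

lemma V_nonempty: "V \<noteq> {}"
proof
  assume "V = {}"
  then have "colorable_from (V \<union> A) L"
    using colorable_from_greedy[OF cover, of A] large by simp
  then show False using not_colorable by simp
qed

lemma card_V_less: "card V < card A"
  using card_V_le_weight bound V_nonempty finV card_gt_0_iff[of V] by linarith

lemma num_colors_pos: "0 < card (c ` V)"
  using V_nonempty finV by (simp add: card_gt_0_iff)

lemma singleton_coloring:
  assumes "a \<in> A" "x \<in> L a"
  shows "partial_coloring {(a, x)} A L"
  using assms unfolding partial_coloring_def by simp

text \<open>With more slack in the bound, a single vertex of \<open>A\<close> could be coloured
  without any gain. In \<open>good_color_class\<close> this inequality beats a count of at most
  \<open>card A - 1\<close>.\<close>

lemma weight_tight: "2 * int (card A) < 3 * weight V A L + 2"
proof -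
  obtain a where a: "a \<in> A" using card_V_less by fastforce
  have "L a \<noteq> {}" using large[OF a] card_V_less by auto
  then obtain x where x: "x \<in> L a" by blast
  have "0 \<le> (\<Sum>v\<in>V. gain {(a, x)} v)"
    by (rule sum_nonneg[OF gain_nonneg[OF singleton_coloring[OF a x]]])
  then show ?thesis
    using weight_after_gain[OF singleton_coloring[OF a x]] by simp
qed

lemma neighbor_exists:
  assumes a: "a \<in> A" and x: "x \<in> L a" and v: "v \<in> V"
  shows "\<exists>w\<in>L v. C x w"
proof (rule ccontr)
  assume "\<not> ?thesis"
  then have "lost L {(a, x)} v = {}" unfolding lost_def by auto
  then have "gain {(a, x)} v = 1" using excess_pos[OF v] unfolding gain_def by simp
  then show False
    using gain_less[OF singleton_coloring[OF a x], of "{v}"] v by simp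
qed

lemma neighbor_unique:
  assumes "a \<in> A" "x \<in> L a" "v \<in> V" "w \<in> L v" "w' \<in> L v" "C x w" "C x w'"
  shows "w = w'"
  using matched[of a v x w w'] assms disj by blast

text \<open>Sending colours to their neighbours injects a list \<open>L a\<close> with
  \<open>a\<close> in \<open>A\<close> into \<open>L v\<close>, so \<open>L v\<close> is at least as
  long. In \<open>bad_excess\<close> this provides a neighbour of \<open>v\<close> in
  \<open>V\<close>.\<close>

lemma degree_ge:
  assumes v: "v \<in> V"
  shows "int (card (c ` V)) + s v \<le> int (card {u\<in>V. E v u}) + 1"
proof -
  obtain a where a: "a \<in> A" using card_V_less by fastforce
  obtain f where f: "\<And>x. x \<in> L a \<Longrightarrow> f x \<in> L v \<and> C x (f x)"
    using neighbor_exists[OF a _ v] by metis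
  have "a \<noteq> v" using a v disj by blast
  have "inj_on f (L a)"
  proof (rule inj_onI)
    fix x y assume "x \<in> L a" "y \<in> L a" "f x = f y"
    then show "x = y"
      using matched[of v a "f x" x y] f[of x] f[of y] C_sym[of x "f x"] C_sym[of y "f y"] a v \<open>a \<noteq> v\<close>
      by simp
  qed
  then have "card (L a) \<le> card (L v)"
    using f finL[of v] v by (intro card_inj_on_le) auto
  then show ?thesis
    using large[OF a] unfolding excess_def by linarith
qed

text \<open>Both \<open>p\<close> and \<open>q\<close> remove the colour \<open>w\<close>, and
  \<open>q\<close> removes no other colour of \<open>L v\<close>, so \<open>S - {q}\<close> accounts
  for all losses.\<close>

lemma gain_pos:
  assumes S: "partial_coloring S A L" and pq: "p \<in> S" "q \<in> S" "p \<noteq> q"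
    and v: "v \<in> V" "w \<in> L v" "C (snd p) w" "C (snd q) w"
  shows "1 \<le> gain S v"
proof -
  have finS: "finite S" and q: "fst q \<in> A" "snd q \<in> L (fst q)"
    using S pq unfolding partial_coloring_def by auto
  have "card (lost L S v) \<le> card (S - {q})"
  proof (rule card_lost_le_partial[OF S v(1)])
    fix y assume "y \<in> lost L S v"
    then obtain r where r: "r \<in> S" "C (snd r) y" "y \<in> L v" unfolding lost_def by blast
    show "\<exists>p\<in>S - {q}. C (snd p) y"
    proof (cases "r = q")
      case True
      then have "y = w" using neighbor_unique[OF q v(1) r(3) v(2)] r v by simp
      then show ?thesis using pq v by blast
    qed (use r in blast)
  qed blast
  moreover have "card (S - {q}) + 1 = card S"
    using card_Suc_Diff1[OF finS pq(2)] by simp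
  ultimately show ?thesis using excess_pos[OF v(1)] unfolding gain_def by simp
qed

section \<open>Bad colours\<close>

definition bad :: "'a \<Rightarrow> 'b \<Rightarrow> 'a \<Rightarrow> 'b \<Rightarrow> 'a \<Rightarrow> bool" where
  "bad a x b y v \<longleftrightarrow> b \<in> A \<and> b \<noteq> a \<and> y \<in> L b \<and> \<not> C x y \<and> v \<in> V \<and> (\<exists>w\<in>L v. C x w \<and> C y w)"

lemma pair_coloring:
  assumes "a \<in> A" "x \<in> L a" "bad a x b y v"
  shows "partial_coloring {(a, x), (b, y)} A L" "card {(a, x), (b, y)} = 2"
  using assms C_sym[of y x] unfolding partial_coloring_def bad_def by auto

lemma gain_pair:
  assumes ax: "a \<in> A" "x \<in> L a" and b: "bad a x b y v"
  shows "1 \<le> gain {(a, x), (b, y)} v"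
proof -
  obtain w where w: "w \<in> L v" "C x w" "C y w" and v: "v \<in> V" and ne: "b \<noteq> a"
    using b unfolding bad_def by blast
  show ?thesis
    by (rule gain_pos[OF pair_coloring(1)[OF ax b], of "(a, x)" "(b, y)" v w]) (use w v ne in auto)
qed

text \<open>Colouring \<open>a\<close> and \<open>b\<close> would gain 1 at each of two vertices, a
  total of 2, beyond what \<open>gain_less\<close> allows.\<close>

lemma bad_vertex_unique:
  assumes ax: "a \<in> A" "x \<in> L a" and b: "bad a x b y v" "bad a x b y v'"
  shows "v = v'"
proof (rule ccontr)
  let ?S = "{(a, x), (b, y)}"
  assume ne: "v \<noteq> v'"
  have v: "v \<in> V" "v' \<in> V" using b unfolding bad_def by auto
  show False
    using gain_pair[OF ax b(1)] gain_pair[OF ax b(2)] gain_less[OF pair_coloring(1)[OF ax b(1)], of "{v, v'}"] v ne pair_coloring(2)[OF ax b(1)]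
    by simp
qed

text \<open>
  If the excess of \<open>v\<close> were \<open>1\<close>, colouring the pair would make \<open>v\<close> removable, which also lowers
  the excess of the neighbours of \<open>v\<close>; the weight then drops by \<open>2\<close> at the cost of two vertices.
\<close>

lemma bad_excess:
  assumes ax: "a \<in> A" "x \<in> L a" and b: "bad a x b y v"
  shows "2 \<le> s v"
proof (rule ccontr)
  assume "\<not> 2 \<le> s v"
  moreover have v: "v \<in> V" using b unfolding bad_def by simp
  ultimately have sv: "s v = 1" using excess_pos[OF v] by simp
  define S where "S = {(a, x), (b, y)}"
  define A' where "A' = A - fst ` S"
  define L' where "L' = residual L S"
  have S: "partial_coloring S A L" "card S = 2"
    using pair_coloring[OF ax b] unfolding S_def by auto
  have g: "1 \<le> gain S v" using gain_pair[OF ax b] unfolding S_def .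
  \<comment> \<open>For excess 1, \<open>degree_ge\<close> bounds the degree below by the number of
    colours in use, which is positive.\<close>
  have "{u\<in>V. E v u} \<noteq> {}"
    using degree_ge[OF v] sv num_colors_pos by (intro notI) simp
  then obtain u where u: "u \<in> V" "E v u" by blast
  have uv: "u \<noteq> v" using u proper by blast
  have le: "excess (V - {v}) A' L' z \<le> excess V A' L' z" for z
    unfolding excess_def using finV by (simp add: card_mono subset_iff)
  have le': "excess V A' L' z \<le> s z" if "z \<in> V" for z
    using excess_residual[OF S(1) that] gain_nonneg[OF S(1) that] unfolding A'_def L'_def gain_def by simp
  have "{z\<in>V - {v}. E u z} \<subset> {z\<in>V. E u z}" using u E_sym v by blast
  then have "card {z\<in>V - {v}. E u z} < card {z\<in>V. E u z}"
    using finV by (intro psubset_card_mono) auto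
  then have "excess (V - {v}) A' L' u \<le> excess V A' L' u - 1"
    unfolding excess_def by simp
  \<comment> \<open>Truncation at 0 is harmless, since \<open>s u - 1\<close> is
    nonnegative.\<close>
  then have eu: "max (excess (V - {v}) A' L' u) 0 \<le> s u - 1"
    using le'[OF u(1)] excess_pos[OF u(1)] by simp
  have ez: "max (excess (V - {v}) A' L' z) 0 \<le> s z" if "z \<in> V" for z
    using le[of z] le'[OF that] excess_pos[OF that] by simp
  have "weight (V - {v}) A' L' = max (excess (V - {v}) A' L' u) 0 +
      (\<Sum>z\<in>V - {v} - {u}. max (excess (V - {v}) A' L' z) 0)"
    unfolding weight_def using finV u uv by (intro sum.remove) auto
  also have "\<dots> \<le> s u - 1 + (\<Sum>z\<in>V - {v} - {u}. s z)"
    using eu ez by (intro add_mono sum_mono) auto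
  also have "\<dots> = (\<Sum>z\<in>V - {v}. s z) - 1"
    using sum.remove[of "V - {v}" u s] finV u uv by simp
  \<comment> \<open>The drop is 1 for \<open>v\<close> itself and 1 for \<open>u\<close>. Three
    times it is 6, while the two coloured vertices cost only 4.\<close>
  also have "\<dots> = weight V A L - 2"
    using sum.remove[OF finV v, of s] sv weight_eq by simp
  finally have w: "3 * weight (V - {v}) A' L' \<le> 2 * (int (card A) - int (card S))"
    using bound S(2) by simp
  have "admissible (V - {v}) A' L'"
    using residual_admissible[OF S(1) Diff_subset w[unfolded A'_def L'_def]] unfolding A'_def L'_def .
  moreover have "card (V - {v}) < card V" using finV v by (intro psubset_card_mono) auto
  moreover have "card A' \<le> card A" unfolding A'_def using finA by (intro card_mono) auto
  ultimately have "colorable_from (V - {v} \<union> A') L'" using smaller_colorable by simp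
  moreover have "list_cover V A' L'"
    using list_cover_mono[OF cover, of V A' L'] residual_subset unfolding A'_def L'_def by blast
  moreover have "excess V A' L' v \<le> 0"
    using excess_residual[OF S(1) v] sv g unfolding A'_def L'_def gain_def by simp
  ultimately have "colorable_from (V \<union> A') L'"
    using colorable_from_nonpos_excess[OF _ v] by blast
  then show False
    using not_colorable_residual[OF S(1)] unfolding A'_def L'_def by simp
qed

text \<open>Otherwise \<open>x\<close>, \<open>y\<close>, \<open>y'\<close> could be used together,
  with total gain at least 2: 1 at each of \<open>v\<close> and \<open>v'\<close> if they differ,
  and 2 at \<open>v\<close> if they coincide, as all three colours then remove the same one. The cap
  in \<open>gain\<close> makes the last case depend on \<open>bad_excess\<close>.\<close>

lemma bad_adjacent:
  assumes ax: "a \<in> A" "x \<in> L a" and b: "bad a x b y v" and b': "bad a x b' y' v'" and ne: "b \<noteq> b'"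
  shows "C y y'"
proof (rule ccontr)
  assume nC: "\<not> C y y'"
  define S where "S = {(a, x), (b, y), (b', y')}"
  obtain w where w: "w \<in> L v" "C x w" "C y w" and v: "v \<in> V" and B: "b \<in> A" "b \<noteq> a" "y \<in> L b" "\<not> C x y"
    using b unfolding bad_def by blast
  obtain w' where w': "w' \<in> L v'" "C x w'" "C y' w'" and v': "v' \<in> V"
      and B': "b' \<in> A" "b' \<noteq> a" "y' \<in> L b'" "\<not> C x y'"
    using b' unfolding bad_def by blast
  have S: "partial_coloring S A L" "card S = 3"
    using ax B B' ne nC C_sym[of y x] C_sym[of y' x] C_sym[of y' y]
    unfolding partial_coloring_def S_def by auto
  have "S \<noteq> {}" unfolding S_def by simp
  note less = gain_less[OF S(1) this]
  show False
  proof (cases "v = v'")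
    case False
    have "1 \<le> gain S v"
      by (rule gain_pos[OF S(1), of "(a, x)" "(b, y)" v w]) (use w v B in \<open>auto simp: S_def\<close>)
    moreover have "1 \<le> gain S v'"
      by (rule gain_pos[OF S(1), of "(a, x)" "(b', y')" v' w']) (use w' v' B' in \<open>auto simp: S_def\<close>)
    ultimately show False using less[of "{v, v'}"] v v' False S(2) by simp
  next
    case True
    have ww': "w' = w" using neighbor_unique[OF ax v _ w(1)] w w' True by blast
    have "card (lost L S v) \<le> card {(a, x)}"
    proof (rule card_lost_le_partial[OF S(1) v])
      fix z assume "z \<in> lost L S v"
      then obtain p where p: "p \<in> S" "z \<in> L v" "C (snd p) z" unfolding lost_def by blast
      have "fst p \<in> A" "snd p \<in> L (fst p)" "C (snd p) w"
        using p(1) ax B B' w w' ww' unfolding S_def by auto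
      then have "z = w" using neighbor_unique[OF _ _ v p(2) w(1) p(3)] by blast
      then show "\<exists>p\<in>{(a, x)}. C (snd p) z" using w by simp
    qed (simp add: S_def)
    then have "2 \<le> gain S v" using S(2) bad_excess[OF ax b] unfolding gain_def by simp
    then show False using less[of "{v}"] v S(2) by simp
  qed
qed

section \<open>An affordable colour class\<close>

definition bad_set :: "'a \<Rightarrow> 'b \<Rightarrow> 'a set \<Rightarrow> 'a set" where
  "bad_set a x I = {b. \<exists>y. \<exists>v\<in>I. bad a x b y v}"

lemma bad_set_subset: "bad_set a x I \<subseteq> A - {a}"
  by (auto simp: bad_set_def bad_def)

text \<open>The last conclusion passes the case distinction on to \<open>contradiction\<close>,
  where it limits how many colours the lists with bad colours lose.\<close>

lemma good_color_class:
  assumes ax: "a \<in> A" "x \<in> L a"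
  obtains i where "i \<in> c ` V"
    and "2 * int (card (bad_set a x {v\<in>V. c v = i})) \<le> 3 * (\<Sum>v | v \<in> V \<and> c v = i. s v)"
    and "card (bad_set a x {v\<in>V. c v = i}) \<le> 1 \<or>
      (\<forall>b y y' v v'. bad a x b y v \<longrightarrow> bad a x b y' v' \<longrightarrow> v = v')"
proof (cases "\<forall>b y y' v v'. bad a x b y v \<longrightarrow> bad a x b y' v' \<longrightarrow> v = v'")
  case True
  let ?B = "\<lambda>v. bad_set a x {v}"
  have finB: "finite (?B v)" for v
    using finite_subset[OF bad_set_subset] finA by simp
  \<comment> \<open>In this case no list has bad colours at two vertices, so the sets
    \<open>?B v\<close> are disjoint.\<close>
  have "(\<Sum>v\<in>V. card (?B v)) = card (\<Union>v\<in>V. ?B v)"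
    using finV finB True by (intro card_UN_disjoint[symmetric]) (auto simp: bad_set_def)
  also have "\<dots> \<le> card (A - {a})"
    using bad_set_subset finA by (intro card_mono UN_least) simp_all
  also have "\<dots> = card A - 1" using ax finA by simp
  finally have "(\<Sum>v\<in>V. int (card (?B v))) \<le> int (card A) - 1"
    using card_V_less by (simp flip: of_nat_sum)
  then have "0 < (\<Sum>v\<in>V. 3 * s v - 2 * int (card (?B v)))"
    using weight_tight weight_eq by (simp add: sum_subtractf flip: sum_distrib_left)
  also have "\<dots> = (\<Sum>i\<in>c ` V. \<Sum>v | v \<in> V \<and> c v = i. 3 * s v - 2 * int (card (?B v)))"
    by (rule sum.image_gen[OF finV])
  finally obtain i where i: "i \<in> c ` V" "0 < (\<Sum>v | v \<in> V \<and> c v = i. 3 * s v - 2 * int (card (?B v)))"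
    using sum_nonpos[of "c ` V"] by (meson not_less)
  let ?I = "{v\<in>V. c v = i}"
  have "bad_set a x ?I = (\<Union>v\<in>?I. ?B v)" unfolding bad_set_def by blast
  then have "card (bad_set a x ?I) \<le> (\<Sum>v\<in>?I. card (?B v))"
    using card_UN_le[of ?I ?B] finV by simp
  then have "2 * int (card (bad_set a x ?I)) \<le> 2 * (\<Sum>v\<in>?I. int (card (?B v)))"
    by (simp flip: of_nat_sum)
  then have "2 * int (card (bad_set a x ?I)) \<le> 3 * (\<Sum>v | v \<in> V \<and> c v = i. s v)"
    using i(2) by (simp add: sum_subtractf flip: sum_distrib_left)
  then show thesis using that i(1) True by blast
next
  case False
  then obtain b y y' v v' where b: "bad a x b y v" "bad a x b y' v'" "v \<noteq> v'" by blast
  have "y \<noteq> y'" using bad_vertex_unique[OF ax] b by blast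
  \<comment> \<open>A bad colour \<open>z\<close> in another list would be adjacent to both
    \<open>y\<close> and \<open>y'\<close>, against the matching condition.\<close>
  have only: "b' = b" if b': "bad a x b' z u" for b' z u
  proof (rule ccontr)
    assume ne: "b' \<noteq> b"
    have "C z y" "C z y'" using bad_adjacent[OF ax b' _ ne] b by blast+
    moreover have "b' \<in> A" "z \<in> L b'" "b \<in> A" "y \<in> L b" "y' \<in> L b"
      using b b' unfolding bad_def by auto
    ultimately show False using matched[of b' b z y y'] ne \<open>y \<noteq> y'\<close> by simp
  qed
  have v: "v \<in> V" using b unfolding bad_def by simp
  let ?I = "{u\<in>V. c u = c v}"
  have "bad_set a x ?I \<subseteq> {b}" unfolding bad_set_def using only by blast
  then have one: "card (bad_set a x ?I) \<le> 1" using card_mono[of "{b}"] by fastforce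
  \<comment> \<open>Positivity of \<open>s v\<close> pays for the single list with bad colours,
    since 2 is at most 3.\<close>
  have "s v \<le> (\<Sum>u\<in>?I. s u)"
    using excess_pos finV v by (intro member_le_sum) fastforce+
  then have "2 * int (card (bad_set a x ?I)) \<le> 3 * (\<Sum>u\<in>?I. s u)"
    using excess_pos[OF v] one by linarith
  then show thesis using that one v by blast
qed

section \<open>Colouring the class and the lists with bad colours\<close>

lemma contradiction: False
proof -
  obtain a where a: "a \<in> A" using card_V_less by fastforce
  have "L a \<noteq> {}" using large[OF a] card_V_less by auto
  then obtain x where x: "x \<in> L a" by blast
  obtain i where i: "i \<in> c ` V"
    and class_bound: "2 * int (card (bad_set a x {v\<in>V. c v = i})) \<le> 3 * (\<Sum>v | v \<in> V \<and> c v = i. s v)"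
    and dichotomy: "card (bad_set a x {v\<in>V. c v = i}) \<le> 1 \<or>
      (\<forall>b y y' v v'. bad a x b y v \<longrightarrow> bad a x b y' v' \<longrightarrow> v = v')"
    using good_color_class[OF a x] by blast
  define I where "I = {v\<in>V. c v = i}"
  define B where "B = bad_set a x I"
  have I: "I \<subseteq> V" "I \<noteq> {}" using i unfolding I_def by auto
  have B: "B \<subseteq> A - {a}" unfolding B_def by (rule bad_set_subset)
  have finI: "finite I" using finite_subset[OF I(1) finV] .
  have finB: "finite B" using finite_subset[OF B] finA by simp
  have BI: "2 * int (card B) \<le> 3 * (\<Sum>v\<in>I. s v)" using class_bound unfolding B_def I_def .
  \<comment> \<open>The vertices of \<open>I\<close> receive neighbours of \<open>x\<close>;
    \<open>a\<close> itself stays uncoloured.\<close>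
  obtain g where g: "\<And>v. v \<in> V \<Longrightarrow> g v \<in> L v \<and> C x (g v)"
    using neighbor_exists[OF a x] by metis
  define S1 where "S1 = (\<lambda>v. (v, g v)) ` I"
  have S1: "partial_coloring S1 (V \<union> A) L"
  proof -
    have "\<not> C (g u) (g v)" if "u \<in> I" "v \<in> I" "u \<noteq> v" for u v
      using adjacent[of u v "g u" "g v"] proper[of u v] that g unfolding I_def by auto
    then show ?thesis
      using I finI g unfolding partial_coloring_def S1_def by (auto simp: inj_on_def)
  qed
  have fst1: "fst ` S1 = I" unfolding S1_def by force
  have card1: "card S1 = card I" using card_fst_partial_coloring[OF S1] fst1 by simp
  have lost1: "\<exists>v\<in>I. C (g v) y \<and> y \<in> L b" if "y \<in> lost L S1 b" for y b
    using that unfolding lost_def S1_def by auto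
  have adj_card: "card {y\<in>L b. C x y} \<le> 1" if "b \<in> A" "b \<noteq> a" for b
    using matched[of a b x] that a x finL[of b] card_le_Suc0_iff_eq[of "{y\<in>L b. C x y}"] by auto
  have badI: "\<exists>v\<in>I. bad a x b y v" if b: "b \<in> A" "b \<noteq> a" "y \<in> lost L S1 b" "\<not> C x y" for b y
  proof -
    obtain v where v: "v \<in> I" "C (g v) y" "y \<in> L b" using lost1[OF b(3)] by blast
    then have "v \<in> V" using I by blast
    then have "bad a x b y v" unfolding bad_def using v b g[of v] C_sym[of "g v" y] by blast
    then show ?thesis using v by blast
  qed
  \<comment> \<open>The list of \<open>a\<close> can lose only \<open>x\<close>. Any other list
    outside \<open>B\<close> can lose only its neighbour of \<open>x\<close>, as it has no bad
    colour for \<open>I\<close>.\<close>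
  have lost_good: "card (lost L S1 b) \<le> 1" if b: "b \<in> A - B" for b
  proof (cases "b = a")
    case True
    have "y = x" if y: "y \<in> lost L S1 a" for y
    proof -
      obtain v where v: "v \<in> I" "C (g v) y" "y \<in> L a" using lost1[OF y] by blast
      then have "v \<in> V" using I by blast
      moreover have "v \<noteq> a" using \<open>v \<in> V\<close> a disj by blast
      ultimately show ?thesis
        using matched[of v a "g v" y x] g[of v] C_sym[of x "g v"] v a x by simp
    qed
    then have "lost L S1 b \<subseteq> {x}" using True by blast
    then show ?thesis using card_mono[of "{x}"] by fastforce
  next
    case False
    have "C x y" if "y \<in> lost L S1 b" for y
      using badI[of b y] that b False unfolding B_def bad_set_def by blast
    then have "lost L S1 b \<subseteq> {y\<in>L b. C x y}" unfolding lost_def by blast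
    then have "card (lost L S1 b) \<le> card {y\<in>L b. C x y}"
      using finL[of b] b by (intro card_mono) auto
    then show ?thesis using adj_card[of b] b False by simp
  qed
  have room: "card B \<le> card (residual L S1 b)" if b: "b \<in> B" for b
  proof -
    have bA: "b \<in> A" "b \<noteq> a" using b B by auto
    \<comment> \<open>The 1 on the right is available because at least one colour is in use. If
      \<open>card B\<close> is at most 1, the crude bound \<open>card I\<close> on the loss
      suffices; otherwise \<open>L b\<close> loses at most its neighbour of \<open>x\<close> and one
      bad colour.\<close>
    have "card (lost L S1 b) + card B \<le> card A + 1"
    proof (cases "card B \<le> 1")
      case True
      have "b \<notin> fst ` S1" using fst1 I bA disj by blast
      then have "card (lost L S1 b) \<le> card I"
        using card_lost_le_card[OF cover S1, of b] bA card1 by simp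
      then show ?thesis
        using True card_mono[OF finV I(1)] card_V_less by linarith
    next
      case False
      then have uniq: "\<And>b y y' v v'. bad a x b y v \<Longrightarrow> bad a x b y' v' \<Longrightarrow> v = v'"
        using dichotomy unfolding B_def I_def by blast
      let ?Y = "{y\<in>L b. \<exists>v\<in>I. bad a x b y v}"
      \<comment> \<open>Colours of \<open>L b\<close> bad at the same \<open>v\<close> share the
        neighbour of \<open>x\<close> in \<open>L v\<close>, so matching identifies them.\<close>
      have "y = y'" if "y \<in> ?Y" "y' \<in> ?Y" for y y'
      proof -
        obtain v where v: "bad a x b y v" "bad a x b y' v" using \<open>y \<in> ?Y\<close> \<open>y' \<in> ?Y\<close> uniq by blast
        then have "v \<in> V" unfolding bad_def by simp
        obtain w w' where w: "w \<in> L v" "C x w" "C y w" "w' \<in> L v" "C x w'" "C y' w'"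
          using v unfolding bad_def by blast
        then have "w' = w" using neighbor_unique[OF a x \<open>v \<in> V\<close>] by blast
        moreover have "v \<noteq> b" using \<open>v \<in> V\<close> bA disj by blast
        ultimately show ?thesis
          using matched[of v b w y y'] w C_sym[of y w] C_sym[of y' w] \<open>v \<in> V\<close> bA that by simp
      qed
      moreover have "finite ?Y" using finL[of b] bA by simp
      ultimately have Y: "card ?Y \<le> 1" using card_le_Suc0_iff_eq[of ?Y] by simp
      have "lost L S1 b \<subseteq> {y\<in>L b. C x y} \<union> ?Y"
        using badI[OF bA] lost1 by blast
      then have "card (lost L S1 b) \<le> card ({y\<in>L b. C x y} \<union> ?Y)"
        using finL[of b] bA by (intro card_mono) auto
      also have "\<dots> \<le> 2" using card_Un_le[of "{y\<in>L b. C x y}" ?Y] Y adj_card[OF bA] by linarith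
      finally have "card (lost L S1 b) \<le> 2" .
      moreover have "card B \<le> card A - 1"
        using card_mono[OF _ B] finA a by simp
      ultimately show ?thesis using card_V_less by linarith
    qed
    then show ?thesis
      using card_residual[of L b S1] finL[of b] bA large[of b] num_colors_pos by simp
  qed
  have "list_cover V A (residual L S1)"
    using list_cover_mono[OF cover] residual_subset by blast
  then have "colorable_from B (residual L S1)"
    using colorable_from_greedy[of V A "residual L S1" B] room B by blast
  then obtain h where h: "\<And>b. b \<in> B \<Longrightarrow> h b \<in> residual L S1 b"
    "\<And>b b'. b \<in> B \<Longrightarrow> b' \<in> B \<Longrightarrow> b \<noteq> b' \<Longrightarrow> \<not> C (h b) (h b')"
    unfolding colorable_from_def by blast
  define S2 where "S2 = (\<lambda>b. (b, h b)) ` B"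
  have fst2: "fst ` S2 = B" unfolding S2_def by force
  have S2: "partial_coloring S2 (V \<union> A) L"
    using h B finB residual_subset unfolding partial_coloring_def S2_def
    by (auto simp: inj_on_def residual_def)
  have card2: "card S2 = card B" using card_fst_partial_coloring[OF S2] fst2 by simp
  define S where "S = S1 \<union> S2"
  have fstS: "fst ` S = I \<union> B" unfolding S_def using fst1 fst2 by (simp add: image_Un)
  have cross: "\<not> C (g v) (h b)" if "v \<in> I" "b \<in> B" for v b
    using h(1)[OF that(2)] that(1) unfolding residual_def lost_def S1_def by auto
  have S: "partial_coloring S (V \<union> A) L"
    unfolding S_def
  proof (rule partial_coloring_Un[OF S1 S2])
    show "fst ` S1 \<inter> fst ` S2 = {}" using fst1 fst2 I B disj by blast
    show "\<not> C (snd p) (snd q)" if "p \<in> S1" "q \<in> S2" for p q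
      using that cross unfolding S1_def S2_def by auto
  qed
  let ?V = "V - I" and ?A = "A - B" and ?L = "residual L S"
  have cA: "int (card ?A) = int (card A) - int (card B)"
  proof -
    have "B \<subseteq> A" using B by blast
    then show ?thesis using card_Diff_subset[OF finB] card_mono[OF finA] by (simp add: of_nat_diff)
  qed
  \<comment> \<open>The loss of \<open>card B\<close> to \<open>S2\<close> is matched by the drop of
    \<open>card A\<close>, and the one further colour by the disappearance of colour
    \<open>i\<close>.\<close>
  have large': "card ?A + card (c ` ?V) \<le> card (?L b)" if b: "b \<in> ?A" for b
  proof -
    have "lost L S b = lost L S1 b \<union> lost L S2 b" unfolding lost_def S_def by blast
    then have "card (lost L S b) \<le> card (lost L S1 b) + card (lost L S2 b)"
      by (simp add: card_Un_le)
    moreover have "card (lost L S2 b) \<le> card B"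
      using card_lost_le_card[OF cover S2, of b] b fst2 card2 by simp
    moreover have "card (c ` ?V) \<le> card (c ` V - {i})"
      using finV unfolding I_def by (intro card_mono) auto
    then have "card (c ` ?V) + 1 \<le> card (c ` V)"
      using i finV card_Suc_Diff1[of "c ` V" i] by simp
    ultimately show ?thesis
      using lost_good[OF b] card_residual[of L b S] finL[of b] b large[of b] cA by simp
  qed
  \<comment> \<open>Losses to neighbours in \<open>I\<close> are offset by the smaller degree,
    losses to \<open>S2\<close> by the smaller \<open>card A\<close>.\<close>
  have excess': "excess ?V ?A ?L u \<le> s u" if u: "u \<in> ?V" for u
  proof -
    let ?N = "{v\<in>I. E u v}"
    have u': "u \<notin> fst ` S" using u fstS B disj by blast
    have "card (lost L S u) \<le> card ((\<lambda>v. (v, g v)) ` ?N \<union> S2)"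
    proof (rule card_lost_le[OF cover S _ u'])
      show "u \<in> V \<union> A" using u by simp
      show "(\<lambda>v. (v, g v)) ` ?N \<union> S2 \<subseteq> S" unfolding S_def S1_def by blast
      fix y assume "y \<in> lost L S u"
      then obtain p where p: "p \<in> S" "C (snd p) y" "y \<in> L u" unfolding lost_def by blast
      show "\<exists>p\<in>(\<lambda>v. (v, g v)) ` ?N \<union> S2. C (snd p) y"
      proof (cases "p \<in> S2")
        case False
        then obtain v where v: "v \<in> I" "p = (v, g v)" using p unfolding S_def S1_def by blast
        then have "v \<in> V" "v \<noteq> u" using I u by auto
        then have "E v u" using adjacent[of v u "g v" y] g[of v] p v u by simp
        then show ?thesis using v p E_sym by blast
      qed (use p in blast)
    qed
    also have "\<dots> \<le> card ((\<lambda>v. (v, g v)) ` ?N) + card S2" by (rule card_Un_le)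
    also have "\<dots> \<le> card ?N + card B" using card_image_le[of ?N] finI card2 by simp
    finally have "card (lost L S u) \<le> card ?N + card B" .
    moreover have "card {v\<in>V. E u v} = card ?N + card {v\<in>?V. E u v}"
    proof -
      have "{v\<in>V. E u v} = ?N \<union> {v\<in>?V. E u v}" using I by blast
      then show ?thesis using finI finV by (simp add: card_Un_disjoint disjoint_iff)
    qed
    ultimately show ?thesis
      unfolding excess_def using card_residual[of L u S] finL[of u] u cA by simp
  qed
  have "weight ?V ?A ?L \<le> (\<Sum>v\<in>?V. max (s v) 0)"
    by (intro weight_mono excess')
  also have "\<dots> = (\<Sum>v\<in>?V. s v)" using excess_pos by (intro sum.cong) fastforce+
  \<comment> \<open>By \<open>BI\<close>, the vanished excess of \<open>I\<close> pays for the
    vertices of \<open>B\<close>.\<close>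
  also have "\<dots> = weight V A L - (\<Sum>v\<in>I. s v)"
    using sum.subset_diff[OF I(1) finV, of s] weight_eq by simp
  finally have "3 * weight ?V ?A ?L \<le> 2 * int (card ?A)" using bound BI cA by simp
  moreover have "list_cover ?V ?A ?L"
    using list_cover_mono[OF cover] residual_subset by blast
  ultimately have "admissible ?V ?A ?L" unfolding admissible_def using large' by blast
  moreover have "card ?V < card V" using finV I by (intro psubset_card_mono) auto
  moreover have "card ?A \<le> card A" using finA by (intro card_mono) auto
  ultimately have "colorable_from (?V \<union> ?A) ?L" using smaller_colorable by simp
  moreover have "?V \<union> ?A = V \<union> A - fst ` S" using fstS I B disj by blast
  ultimately have "colorable_from (V \<union> A) L" using colorable_from_extend[OF S] by simp
  then show False using not_colorable by simp
qed

end

section \<open>Induction on the number of vertices\<close>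

context conflict_graph
begin

lemma admissible_imp_colorable:
  "admissible V A L \<Longrightarrow> colorable_from (V \<union> A) L"
proof (induction "card V + card A" arbitrary: V A L rule: less_induct)
  case less
  show ?case
  proof (rule ccontr)
    assume "\<not> ?thesis"
    then interpret minimal_counterexample E C c V A L
      using less by unfold_locales blast+
    show False by (rule contradiction)
  qed
qed

end

section \<open>Transfer to covers of the join\<close>

lemma edges_between_matching:
  assumes H: "pair_graph H" and M: "matching (edges_between H X Y)"
    and disj: "X \<inter> Y = {}" and x: "x \<in> X" and y: "y \<in> Y" "(x, y) \<in> parcs H"
    and z: "z \<in> Y" "(x, z) \<in> parcs H"
  shows "y = z"
proof (rule ccontr)
  assume ne: "y \<noteq> z"
  have e: "{x, y} \<in> edges_between H X Y" "{x, z} \<in> edges_between H X Y"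
    unfolding edges_between_def using x y z by blast+
  have "{x, y} \<noteq> {x, z}" using ne by (auto simp: doubleton_eq_iff)
  then have "disjnt {x, y} {x, z}" by (rule pairwiseD[OF M[unfolded matching_def] e])
  then show False unfolding disjnt_def by blast
qed

theorem theorem2p1:
  fixes k :: nat
    and G :: "'a pair_pre_digraph"
    and A :: "'a set"
    and L :: "'a \<Rightarrow> 'b set"
    and H :: "'b pair_pre_digraph"
  assumes "pair_graph G"
    and "colorable k G"
    and "finite A"
    and "A \<inter> pverts G = {}"
    and "cover (\<J> G A) L H"
    and "\<forall>a \<in> A. card (L a) \<ge> card A + k"
    and "real (card A) \<ge> 3 / 2 * (\<Sum>v \<in> pverts G.
           max (real (vertex_degree G v) + real (card A) - real (card (L v)) + 1) 0)"
  shows "cover_colorable (\<J> G A) L H"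
proof -
  interpret G: pair_graph G by fact
  let ?V = "pverts G"
  let ?J = "\<J> G A"
  have H: "pair_graph H" using assms(5) unfolding cover_def by blast
  interpret H: pair_graph H by fact
  obtain c where c: "\<And>v. v \<in> ?V \<Longrightarrow> c v < k" "\<And>u v. (u, v) \<in> parcs G \<Longrightarrow> c u \<noteq> c v"
    using assms(2) unfolding colorable_def by blast
  define E where "E u v \<longleftrightarrow> (u, v) \<in> parcs G" for u v
  define C where "C x y \<longleftrightarrow> (x, y) \<in> parcs H" for x y
  interpret conflict_graph E C c
    using c(2) G.arcs_symmetric H.arcs_symmetric unfolding E_def C_def by unfold_locales auto
  have verts: "pverts ?J = ?V \<union> A" unfolding clique_join_def by simp
  have arcs: "(u, v) \<in> parcs ?J \<longleftrightarrow>
      (u, v) \<in> parcs G \<or> u \<in> ?V \<union> A \<and> v \<in> ?V \<union> A \<and> u \<noteq> v \<and> (u \<in> A \<or> v \<in> A)" for u v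
    unfolding clique_join_def by simp
  have union: "(\<Union>u\<in>?V \<union> A. L u) = pverts H" and disjL: "disjoint_family_on L (?V \<union> A)"
    and edge: "\<And>u v x y. u \<in> ?V \<union> A \<Longrightarrow> v \<in> ?V \<union> A \<Longrightarrow> x \<in> L v \<Longrightarrow> y \<in> L u \<Longrightarrow> (x, y) \<in> parcs H \<Longrightarrow>
      v = u \<or> (u, v) \<in> parcs ?J"
    and mat: "\<And>u v. (u, v) \<in> parcs ?J \<Longrightarrow> matching (edges_between H (L u) (L v))"
    using assms(5) unfolding cover_def verts by blast+
  have disj: "L u \<inter> L v = {}" if "u \<in> ?V \<union> A" "v \<in> ?V \<union> A" "u \<noteq> v" for u v
    using disjL that unfolding disjoint_family_on_def by blast
  have "list_cover ?V A L"
    unfolding list_cover_def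
  proof (intro conjI ballI impI)
    show "finite ?V" "finite A" "?V \<inter> A = {}" using assms(3,4) G.pair_finite_verts by auto
    show "finite (L u)" if "u \<in> ?V \<union> A" for u
    proof (rule finite_subset)
      show "L u \<subseteq> pverts H" using union that by blast
    qed simp
    show "y = z" if "u \<in> ?V \<union> A" "v \<in> ?V \<union> A" "u \<noteq> v" "x \<in> L u" "y \<in> L v" "z \<in> L v" "C x y" "C x z"
      for u v x y z
    proof (rule edges_between_matching[OF H])
      have "(v, u) \<in> parcs ?J"
        using edge[of v u x y] that unfolding C_def by blast
      then have "(u, v) \<in> parcs ?J" using arcs G.arcs_symmetric by blast
      then show "matching (edges_between H (L u) (L v))" by (rule mat)
      show "L u \<inter> L v = {}" using disj that by blast
    qed (use that in \<open>auto simp: C_def\<close>)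
    show "\<not> C x y" if "u \<in> ?V" "v \<in> ?V" "u \<noteq> v" "\<not> E u v" "x \<in> L u" "y \<in> L v" for u v x y
    proof
      assume "C x y"
      then have "(v, u) \<in> parcs ?J" using edge[of v u x y] that unfolding C_def by blast
      then have "(u, v) \<in> parcs G" using arcs that(1,2) assms(4) G.arcs_symmetric by blast
      then show False using that(4) unfolding E_def by simp
    qed
  qed
  moreover have "card A + card (c ` ?V) \<le> card (L a)" if "a \<in> A" for a
  proof -
    \<comment> \<open>\<open>admissible\<close> counts the colours actually used, of which there are
      at most \<open>k\<close>.\<close>
    have "card (c ` ?V) \<le> card {..<k}" using c(1) by (intro card_mono) auto
    then show ?thesis using assms(6) that by fastforce
  qed
  moreover have "3 * weight ?V A L \<le> 2 * int (card A)"
  proof -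
    have deg: "vertex_degree G v = card {u\<in>?V. E v u}" for v
    proof -
      have "out_arcs (with_proj G) v = Pair v ` {u\<in>?V. E v u}"
        unfolding out_arcs_def E_def using G.in_arcsD2 by force
      then show ?thesis unfolding out_degree_def by (simp add: card_image inj_on_def)
    qed
    have "real_of_int (weight ?V A L) = (\<Sum>v \<in> ?V.
           max (real (vertex_degree G v) + real (card A) - real (card (L v)) + 1) 0)"
      unfolding weight_def excess_def deg by (simp add: of_int_max)
    then have "real_of_int (3 * weight ?V A L) \<le> real_of_int (2 * int (card A))"
      using assms(7) by simp
    then show ?thesis by (simp only: of_int_le_iff)
  qed
  ultimately have "colorable_from (?V \<union> A) L"
    using admissible_imp_colorable unfolding admissible_def by blast
  then obtain \<phi> where \<phi>: "\<And>u. u \<in> ?V \<union> A \<Longrightarrow> \<phi> u \<in> L u"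
    "\<And>u v. u \<in> ?V \<union> A \<Longrightarrow> v \<in> ?V \<union> A \<Longrightarrow> u \<noteq> v \<Longrightarrow> \<not> C (\<phi> u) (\<phi> v)"
    unfolding colorable_from_def by blast
  let ?I = "\<phi> ` (?V \<union> A)"
  have "independent_set H ?I"
    unfolding independent_set_def
  proof (intro conjI ballI)
    show "?I \<subseteq> pverts H" using \<phi>(1) union by blast
    fix x y assume "x \<in> ?I" "y \<in> ?I"
    then obtain u v where uv: "u \<in> ?V \<union> A" "v \<in> ?V \<union> A" "x = \<phi> u" "y = \<phi> v" by blast
    show "(x, y) \<notin> parcs H"
      using \<phi>(2)[OF uv(1,2)] uv(3,4) H.no_loops' unfolding C_def by (cases "u = v") auto
  qed
  moreover have "card (?I \<inter> L u) = 1" if u: "u \<in> pverts ?J" for u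
  proof -
    \<comment> \<open>Disjointness of the lists keeps the colours chosen at other vertices out of
      \<open>L u\<close>.\<close>
    have "?I \<inter> L u = {\<phi> u}"
      using u \<phi>(1) disj unfolding verts by blast
    then show ?thesis by simp
  qed
  ultimately show ?thesis
    unfolding cover_colorable_def cover_coloring_def by blast
qed

end
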